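(* Let $d\ge 1$ and let $p_1,\dots,p_{d-1}$ be positive integers and $p_d\ge 2$ an integer. Let $\alpha=p_1+\cdots+p_{d-1}$ and $k=\left\lfloor\frac{p_d-2}{\alpha+1}\right\rfloor$. Suppose that $p_d\geq \alpha^2-\alpha$. Let $$T_{p_1\dots p_d}=\operatorname{conv}\{e_1,\dots,e_{d+1},(p_1,\dots,p_d,1)\}\subset\mathbb R^{d+1},$$ where $e_1,\dots,e_{d+1}$ is the standard basis of $\mathbb R^{d+1}$. Then $\operatorname{ls}_\square(T_{p_1\dots p_d})=k+2$.
   Context: An affine unimodular map $L\colon\mathbb R^{n}\to\mathbb R^{n}$ is a map $x\mapsto Ax+v$ with $A$ an integer $n\times n$ matrix of determinant $\pm1$ and $v\in\mathbb Z^{n}$. For a lattice polytope $P\subset\mathbb R^n$ (convex hull of finitely many points of $\mathbb Z^n$), the lattice size $\operatorname{ls}_\square(P)$ with respect to the unit cube $\square=[0,1]^n$ is the smallest $l$ such that $L(P)\subseteq l\square=[0,l]^n$ for some affine unimodular map $L$. *)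

theory Defs
  imports "HOL-Analysis.Analysis"
begin

definition lattice_polytope :: "(real^'n) set \<Rightarrow> bool" where
  "lattice_polytope P \<longleftrightarrow>
     (\<exists>S. finite S \<and> (\<forall>x\<in>S. \<forall>i. x $ i \<in> \<int>) \<and> P = convex hull S)"

definition affine_unimodular :: "(real^'n \<Rightarrow> real^'n) \<Rightarrow> bool" where
  "affine_unimodular L \<longleftrightarrow>
     (\<exists>A v. (\<forall>i j. A $ i $ j \<in> \<int>) \<and> (det A = 1 \<or> det A = -1) \<and>
            (\<forall>i. v $ i \<in> \<int>) \<and> L = (\<lambda>x. A *v x + v))"

text \<open>The minimum is taken over all real \<open>l \<ge> 0\<close>, not only over the integers.
  It exists for every lattice polytope, and \<^term>\<open>cbox 0 (vec l :: real^'n)\<close> is the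
  dilated cube \<open>[0,l]^n\<close>.\<close>

definition lattice_size_cube :: "(real^'n) set \<Rightarrow> real" where
  "lattice_size_cube P =
     (LEAST l. 0 \<le> l \<and> (\<exists>L. affine_unimodular L \<and> L ` P \<subseteq> cbox 0 (vec l)))"

text \<open>The map \<open>ix\<close> numbers the coordinates of \<^typ>\<open>real^'n\<close> by \<open>1, \<dots>, d + 1\<close>, so that
  \<open>axis (ix i) 1\<close> is the standard basis vector \<open>e\<^sub>i\<close>, and the last
  vertex is \<open>(p\<^sub>1, \<dots>, p\<^sub>d, 1)\<close>. It is meant to be used with a bijection
  from \<open>{1..d + 1}\<close> onto the index type.\<close>

definition simplex_T :: "(nat \<Rightarrow> 'n::finite) \<Rightarrow> nat \<Rightarrow> (nat \<Rightarrow> int) \<Rightarrow> (real^'n) set" where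
  "simplex_T ix d p =
     convex hull (insert ((\<Sum>i = 1..d. of_int (p i) *\<^sub>R axis (ix i) 1) + axis (ix (d + 1)) 1)
                         ((\<lambda>i. axis (ix i) 1) ` {1..d + 1}))"

lemma lattice_polytope_simplex_T: "lattice_polytope (simplex_T ix d p)"
  unfolding lattice_polytope_def simplex_T_def
  by (rule exI, rule conjI[rotated], rule conjI[OF _ refl])
     (auto simp: axis_def intro!: Ints_add Ints_sum Ints_mult)

end

theory Submission
  imports Defs
begin

text \<open>
  Lower bound: some row \<open>u\<close> of a unimodular matrix has \<open>u\<^sub>d \<noteq> 0\<close>. If all vertex values of
  \<open>u\<close> differ by at most \<open>m\<close>, then writing
  \<open>(\<alpha> + p\<^sub>d) u\<^sub>d = \<Sum>\<^sub>i p\<^sub>i u\<^sub>i + \<Sum>\<^sub>i\<^sub><\<^sub>d p\<^sub>i (u\<^sub>d - u\<^sub>i)\<close> gives \<open>\<alpha> + p\<^sub>d \<le> (\<alpha> + 1) m\<close>,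
  which forces \<open>m \<ge> k + 2\<close>.
  Upper bound: replace row \<open>d\<close> of the identity matrix by \<open>(-(k+1), \<dots>, -(k+1), 1, a)\<close>, where
  \<open>a\<close> is \<open>-(k+1)\<close> or \<open>1\<close>. The hypothesis \<open>p\<^sub>d \<ge> \<alpha>\<^sup>2 - \<alpha>\<close> gives \<open>\<alpha> \<le> k + 2\<close>,
  which bounds the widths \<open>p\<^sub>i\<close> of the remaining rows.
\<close>

lemma weighted_sum_width_bound:
  fixes p u :: "nat \<Rightarrow> int"
  assumes "d \<ge> 1" and "\<And>i. i \<in> {1..<d} \<Longrightarrow> p i \<ge> 0" and "p d \<ge> 0"
    and ud: "u d \<noteq> 0"
    and diff: "\<And>i. i \<in> {1..<d} \<Longrightarrow> \<bar>u d - u i\<bar> \<le> m"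
    and total: "\<bar>\<Sum>i = 1..d. p i * u i\<bar> \<le> m"
  shows "(\<Sum>i = 1..<d. p i) + p d \<le> ((\<Sum>i = 1..<d. p i) + 1) * m"
proof -
  let ?\<alpha> = "\<Sum>i = 1..<d. p i"
  have split: "{1..d} = insert d {1..<d}" using assms(1) by auto
  have \<alpha>0: "?\<alpha> \<ge> 0" using assms(2) by (intro sum_nonneg) auto
  have eq: "(?\<alpha> + p d) * u d = (\<Sum>i = 1..d. p i * u i) + (\<Sum>i = 1..<d. p i * (u d - u i))"
    unfolding split by (simp add: algebra_simps sum_subtractf sum_distrib_left)
  have "\<bar>\<Sum>i = 1..<d. p i * (u d - u i)\<bar> \<le> (\<Sum>i = 1..<d. p i * m)"
    using assms(2) diff
    by (intro order.trans[OF sum_abs] sum_mono) (auto simp: abs_mult intro!: mult_left_mono)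
  also have "\<dots> = ?\<alpha> * m" by (simp add: sum_distrib_right)
  finally have "\<bar>(?\<alpha> + p d) * u d\<bar> \<le> (?\<alpha> + 1) * m"
    using total unfolding eq by (simp add: algebra_simps)
  \<comment> \<open>\<open>u d\<close> is a nonzero integer, so its absolute value is at least
    1.\<close>
  moreover have "(?\<alpha> + p d) * 1 \<le> (?\<alpha> + p d) * \<bar>u d\<bar>"
    using \<alpha>0 assms(3) ud by (intro mult_left_mono) auto
  ultimately show ?thesis
    using \<alpha>0 assms(3) by (simp add: abs_mult)
qed

text \<open>This is Cramer's rule for the identity matrix. The transpose enters because
  \<open>cramer_lemma\<close> replaces a column, not a row.\<close>

lemma det_mat_replace_row:
  fixes c :: "real^'n"
  shows "det (\<chi> i. if i = r then c else axis i 1) = c $ r"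
proof -
  have "(\<chi> i. if i = r then c else axis i 1) =
        transpose (\<chi> i j. if j = r then (mat 1 *v c) $ i else mat 1 $ i $ j)"
    unfolding matrix_vector_mul_lid by (auto simp: vec_eq_iff transpose_def axis_def mat_def)
  then show ?thesis by (simp add: det_transpose cramer_lemma)
qed

lemma unimodular_column_nonzero:
  fixes A :: "real^'n^'n"
  assumes "det A \<noteq> 0"
  obtains r where "A $ r $ c \<noteq> 0"
proof -
  have "column c A \<noteq> 0"
    using assms det_zero_column(1) [of c A] by auto
  then show ?thesis using that by (auto simp: vec_eq_iff column_def)
qed

text \<open>The preimage of a box under an affine map is convex, so it contains a hull as soon as it
  contains the generators.\<close>

lemma affine_image_convex_hull_subset_cbox_iff:
  fixes A :: "real^'n^'n"
  shows "(\<lambda>x. A *v x + v) ` (convex hull S) \<subseteq> cbox a b \<longleftrightarrow> (\<forall>x\<in>S. A *v x + v \<in> cbox a b)"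
proof -
  \<comment> \<open>Moving the translation into the box leaves the preimage of a box under a linear
    map, as \<open>convex_linear_vimage\<close> requires.\<close>
  have eq: "A *v x + v \<in> cbox a b \<longleftrightarrow> A *v x \<in> cbox (a - v) (b - v)" for x
    by (auto simp: mem_box_cart algebra_simps)
  have "convex ((*v) A -` cbox (a - v) (b - v))"
    by (intro convex_linear_vimage convex_box matrix_vector_mul_linear)
  then have "convex {x. A *v x + v \<in> cbox a b}"
    by (simp add: eq vimage_def)
  then have "convex hull S \<subseteq> {x. A *v x + v \<in> cbox a b} \<longleftrightarrow> S \<subseteq> {x. A *v x + v \<in> cbox a b}"
    by (meson hull_minimal hull_subset order.trans)
  then show ?thesis by auto
qed

lemma simplex_T_image_subset_cbox_iff:
  fixes A :: "real^'n::finite^'n"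
  shows "(\<lambda>x. A *v x + v) ` simplex_T ix d p \<subseteq> cbox 0 (vec l) \<longleftrightarrow>
    (\<forall>j. 0 \<le> (\<Sum>i = 1..d. p i * A $ j $ ix i) + A $ j $ ix (d + 1) + v $ j \<and>
         (\<Sum>i = 1..d. p i * A $ j $ ix i) + A $ j $ ix (d + 1) + v $ j \<le> l) \<and>
    (\<forall>i\<in>{1..d + 1}. \<forall>j. 0 \<le> A $ j $ ix i + v $ j \<and> A $ j $ ix i + v $ j \<le> l)"
proof -
  have "(A *v axis i 1) $ j = A $ j $ i" for i j
    by (simp add: matrix_vector_mul_component inner_axis)
  moreover have "(A *v ((\<Sum>i = 1..d. of_int (p i) *\<^sub>R axis (ix i) 1) + axis (ix (d + 1)) 1)) $ j
      = (\<Sum>i = 1..d. p i * A $ j $ ix i) + A $ j $ ix (d + 1)" for j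
    by (simp add: matrix_vector_mul_component inner_axis inner_add_right inner_sum_right)
  ultimately show ?thesis
    unfolding simplex_T_def affine_image_convex_hull_subset_cbox_iff
    by (auto simp: mem_box_cart)
qed

lemma simplex_T_width_bound:
  fixes ix :: "nat \<Rightarrow> 'n::finite" and p :: "nat \<Rightarrow> int" and L :: "real^'n \<Rightarrow> real^'n"
  assumes "d \<ge> 1" and "\<And>i. i \<in> {1..<d} \<Longrightarrow> p i \<ge> 0" and "p d \<ge> 0"
    and L: "affine_unimodular L" "L ` simplex_T ix d p \<subseteq> cbox 0 (vec l)"
  shows "(\<Sum>i = 1..<d. p i) + p d \<le> ((\<Sum>i = 1..<d. p i) + 1) * \<lfloor>l\<rfloor>"
proof -
  obtain A v where A: "\<And>i j. A $ i $ j \<in> \<int>" "det A = 1 \<or> det A = -1"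
    and Lv: "L = (\<lambda>x. A *v x + v)"
    using L(1) unfolding affine_unimodular_def by blast
  have "det A \<noteq> 0" using A(2) by auto
  then obtain r where r: "A $ r $ ix d \<noteq> 0"
    by (rule unimodular_column_nonzero)
  define u where "u i = \<lfloor>A $ r $ ix i\<rfloor>" for i
  have u: "A $ r $ ix i = of_int (u i)" for i
    using A(1) by (simp add: u_def)
  have bounds: "0 \<le> (\<Sum>i = 1..d. p i * u i) + u (d + 1) + v $ r"
      "(\<Sum>i = 1..d. p i * u i) + u (d + 1) + v $ r \<le> l"
      "\<And>i. i \<in> {1..d + 1} \<Longrightarrow> 0 \<le> u i + v $ r \<and> u i + v $ r \<le> l"
    using L(2) unfolding Lv simplex_T_image_subset_cbox_iff
    by (simp_all flip: u)
  \<comment> \<open>The shift \<open>v $ r\<close> cancels when two vertex values are subtracted.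
    The pairs compared are e_d with e_i, and the last vertex with e_{d+1}, which differ by (p_1,
    ..., p_d, 0). The differences are integers, so the real bound \<open>l\<close> can be rounded
    down.\<close>
  show ?thesis
  proof (rule weighted_sum_width_bound)
    show "u d \<noteq> 0" using r by (simp add: u)
    show "\<bar>u d - u i\<bar> \<le> \<lfloor>l\<rfloor>" if "i \<in> {1..<d}" for i
      using bounds(3)[of i] bounds(3)[of d] that assms(1) by (simp add: le_floor_iff abs_le_iff)
    show "\<bar>\<Sum>i = 1..d. p i * u i\<bar> \<le> \<lfloor>l\<rfloor>"
      using bounds(1,2) bounds(3)[of "d + 1"] by (simp add: le_floor_iff abs_le_iff)
  qed (use assms in auto)
qed

text \<open>The theorem uses this with \<open>m = k + 1\<close>. The number bounded in the last
  hypothesis is what row (-m, ..., -m, 1) gives on (p_1, ..., p_d).\<close>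

lemma simplex_T_fits_in_cube:
  fixes ix :: "nat \<Rightarrow> 'n::finite" and p :: "nat \<Rightarrow> int" and m :: int
  assumes bij: "bij_betw ix {1..d + 1} UNIV" and "d \<ge> 1"
    and p: "\<And>i. i \<in> {1..<d} \<Longrightarrow> 0 \<le> p i \<and> p i \<le> m + 1" and "m \<ge> 0"
    and D: "\<bar>p d - m * (\<Sum>i = 1..<d. p i)\<bar> \<le> m + 1"
  shows "\<exists>L. affine_unimodular L \<and> L ` simplex_T ix d p \<subseteq> cbox 0 (vec (of_int (m + 1)))"
proof -
  define D where "D = p d - m * (\<Sum>i = 1..<d. p i)"
  \<comment> \<open>Row \<open>ix d\<close> takes the values -m, 1, \<open>a\<close> and
    \<open>D + a\<close> at the vertices, and all must lie in [-m, 1]. For 0 \<le> D \<le> m + 1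
    this allows a = -m; for -(m + 1) \<le> D < 0 it allows a = 1.\<close>
  define a where "a = (if D \<ge> 0 then - m else 1)"
  define c :: "real^'n" where
    "c = (\<chi> j. if j = ix d then 1 else if j = ix (d + 1) then of_int a else - of_int m)"
  define A :: "real^'n^'n" where "A = (\<chi> j. if j = ix d then c else axis j 1)"
  \<comment> \<open>The shift by \<open>m\<close> carries [-m, 1] onto [0, m + 1].\<close>
  define v :: "real^'n" where "v = axis (ix d) (of_int m)"
  have ix_eq: "ix i = ix j \<longleftrightarrow> i = j" if "i \<in> {1..d + 1}" "j \<in> {1..d + 1}" for i j
    using bij that by (auto simp: bij_betw_def inj_on_def)
  have Ad: "A $ ix d $ ix i = (if i = d then 1 else if i = d + 1 then of_int a else - of_int m)"
    if "i \<in> {1..d + 1}" for i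
    using that \<open>d \<ge> 1\<close> by (simp add: A_def c_def ix_eq)
  have Aj: "A $ ix j $ ix i = (if i = j then 1 else 0)"
    if "i \<in> {1..d + 1}" "j \<in> {1..d + 1}" "j \<noteq> d" for i j
    using that \<open>d \<ge> 1\<close> by (simp add: A_def axis_def ix_eq)
  have split: "{1..d} = insert d {1..<d}" using \<open>d \<ge> 1\<close> by auto
  have "(\<Sum>i = 1..d. p i * A $ ix d $ ix i) = (\<Sum>i = 1..<d. p i * - of_int m) + p d"
    unfolding split using \<open>d \<ge> 1\<close> by (simp add: Ad)
  then have sum_d: "(\<Sum>i = 1..d. p i * A $ ix d $ ix i) = of_int D"
    by (simp add: D_def sum_negf sum_distrib_left mult.commute)
  have sum_j: "(\<Sum>i = 1..d. p i * A $ ix j $ ix i) = (if j = d + 1 then 0 else p j)"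
    if "j \<in> {1..d + 1}" "j \<noteq> d" for j
  proof -
    have "(\<Sum>i = 1..d. p i * A $ ix j $ ix i) = (\<Sum>i = 1..d. if i = j then real_of_int (p j) else 0)"
      using that by (intro sum.cong) (auto simp: Aj)
    then show ?thesis using that by (auto simp: sum.delta)
  qed
  have "(\<lambda>x. A *v x + v) ` simplex_T ix d p \<subseteq> cbox 0 (vec (of_int (m + 1)))"
  proof -
    have row: "0 \<le> (\<Sum>i = 1..d. p i * A $ ix j $ ix i) + A $ ix j $ ix (d + 1) + v $ ix j \<and>
        (\<Sum>i = 1..d. p i * A $ ix j $ ix i) + A $ ix j $ ix (d + 1) + v $ ix j \<le> of_int (m + 1) \<and>
        (\<forall>i\<in>{1..d + 1}. 0 \<le> A $ ix j $ ix i + v $ ix j \<and> A $ ix j $ ix i + v $ ix j \<le> of_int (m + 1))"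
      if j: "j \<in> {1..d + 1}" for j
    proof (cases "j = d")
      case True
      have "0 \<le> D + a + m" "D + a + m \<le> m + 1" "0 \<le> a + m" "a \<le> 1"
        using assms(4) D[folded D_def] by (auto simp: a_def)
      then have "0 \<le> real_of_int D + a + m" "real_of_int D + a + m \<le> m + 1"
          "0 \<le> real_of_int a + m" "real_of_int a \<le> 1"
        by linarith+
      then show ?thesis
        unfolding True sum_d using assms(2,4) by (auto simp: Ad v_def)
    next
      case False
      then have "v $ ix j = 0"
        using j assms(2) by (simp add: v_def axis_def ix_eq)
      moreover have "j \<in> {1..<d}" if "j \<noteq> d + 1" using that j False by auto
      \<comment> \<open>An unchanged row is 0 or 1 at the basis vectors. At the last vertex it is
        \<open>p j\<close> for j < d, at most m + 1 by hypothesis, and 1 for j = d + 1.\<close>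
      ultimately show ?thesis
        unfolding sum_j[OF j False] using False j assms(2,4) p[of j] by (auto simp: Aj)
    qed
    have "(\<forall>j. P j) \<longleftrightarrow> (\<forall>j\<in>{1..d + 1}. P (ix j))" for P
      using bij by (metis UNIV_I bij_betw_imp_surj_on imageE)
    then show ?thesis
      unfolding simplex_T_image_subset_cbox_iff using row by simp
  qed
  moreover have "affine_unimodular (\<lambda>x. A *v x + v)"
    unfolding affine_unimodular_def
  proof (intro exI conjI allI)
    show "A $ i $ j \<in> \<int>" for i j by (simp add: A_def c_def axis_def)
    show "v $ i \<in> \<int>" for i by (simp add: v_def axis_def)
    show "det A = 1 \<or> det A = -1"
      by (simp add: A_def det_mat_replace_row c_def)
  qed simp
  ultimately show ?thesis by blast
qed

theorem theorem3p5:
  fixes d :: nat and p :: "nat \<Rightarrow> int" and \<alpha> k :: int and ix :: "nat \<Rightarrow> 'n::finite"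
  assumes "bij_betw ix {1..d + 1} UNIV"
    and "d \<ge> 1"
    and "\<And>i. i \<in> {1..<d} \<Longrightarrow> p i > 0"
    and "p d \<ge> 2"
    and "\<alpha> = (\<Sum>i = 1..<d. p i)"
    and "k = \<lfloor>of_int (p d - 2) / (of_int (\<alpha> + 1) :: real)\<rfloor>"
    and "p d \<ge> \<alpha>\<^sup>2 - \<alpha>"
  shows "lattice_size_cube (simplex_T ix d p) = of_int (k + 2)"
proof -
  have \<alpha>0: "\<alpha> \<ge> 0" unfolding assms(5) using assms(3) by (intro sum_nonneg) (auto simp: less_imp_le)
  have k: "k = (p d - 2) div (\<alpha> + 1)"
    unfolding assms(6) by (rule floor_divide_of_int_eq)
  have k0: "k \<ge> 0" using assms(4) \<alpha>0 by (simp add: k pos_imp_zdiv_nonneg_iff)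
  have "p d - 2 = (\<alpha> + 1) * k + (p d - 2) mod (\<alpha> + 1)"
    unfolding k by simp
  then have k_le: "(\<alpha> + 1) * k \<le> p d - 2" and k_ge: "p d - 2 \<le> (\<alpha> + 1) * k + \<alpha>"
    using \<alpha>0 pos_mod_sign[of "\<alpha> + 1" "p d - 2"] pos_mod_bound[of "\<alpha> + 1" "p d - 2"] by linarith+
  \<comment> \<open>The left side is \<alpha>^2 - \<alpha> - 2, hence at most p_d - 2, and the
    division remainder is at most \<alpha>. Cancelling \<alpha> + 1 gives \<alpha> - 2 < k +
    1.\<close>
  have "(\<alpha> + 1) * (\<alpha> - 2) < (\<alpha> + 1) * (k + 1)"
    using k_ge assms(7) by (simp add: algebra_simps power2_eq_square)
  then have \<alpha>k: "\<alpha> \<le> k + 2" using \<alpha>0 by (simp add: mult_less_cancel_left)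
  have pk: "0 \<le> p i \<and> p i \<le> (k + 1) + 1" if "i \<in> {1..<d}" for i
  proof -
    have "p i \<le> \<alpha>"
      unfolding assms(5) using that assms(3) by (intro member_le_sum) (auto simp: less_imp_le)
    then show ?thesis using \<alpha>k assms(3)[OF that] by simp
  qed
  have "p d - (k + 1) * \<alpha> \<le> k + 2" using k_ge by (simp add: algebra_simps)
  \<comment> \<open>\<open>k_le\<close> gives p_d - (k + 1) \<alpha> \<ge> k + 2 - \<alpha>, which
    is nonnegative by \<open>\<alpha>k\<close>.\<close>
  moreover have "- (k + 2) \<le> p d - (k + 1) * \<alpha>"
    using k_le k0 \<alpha>k by (simp add: algebra_simps)
  ultimately have "\<bar>p d - (k + 1) * (\<Sum>i = 1..<d. p i)\<bar> \<le> (k + 1) + 1"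
    unfolding assms(5)[symmetric] by linarith
  then have ex: "\<exists>L. affine_unimodular L \<and> L ` simplex_T ix d p \<subseteq> cbox 0 (vec (of_int ((k + 1) + 1)))"
    using assms(1,2) pk k0 by (intro simplex_T_fits_in_cube) auto
  show ?thesis
    unfolding lattice_size_cube_def
  proof (rule Least_equality)
    show "0 \<le> real_of_int (k + 2) \<and>
        (\<exists>L. affine_unimodular L \<and> L ` simplex_T ix d p \<subseteq> cbox 0 (vec (real_of_int (k + 2))))"
      using ex k0 by (simp add: add.assoc)
  next
    fix l :: real
    assume "0 \<le> l \<and> (\<exists>L. affine_unimodular L \<and> L ` simplex_T ix d p \<subseteq> cbox 0 (vec l))"
    then have "\<alpha> + p d \<le> (\<alpha> + 1) * \<lfloor>l\<rfloor>"
      unfolding assms(5) using assms(2-4) pk by (elim conjE exE) (rule simplex_T_width_bound, auto)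
    \<comment> \<open>By \<open>k_le\<close>, \<alpha> + p_d is at least (\<alpha> + 1)(k + 1) + 1.
      The extra 1 makes the inequality strict and so lifts the bound from k + 1 to k + 2.\<close>
    then have "(\<alpha> + 1) * (k + 1) < (\<alpha> + 1) * \<lfloor>l\<rfloor>"
      using k_le by (simp add: algebra_simps)
    then have "k + 2 \<le> \<lfloor>l\<rfloor>" using \<alpha>0 by (simp add: mult_less_cancel_left)
    then show "real_of_int (k + 2) \<le> l" by (simp add: le_floor_iff)
  qed
qed

end
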